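(* Let $\mathcal{V}$ be a risk-averse expected disutility function, $\Phi=\mathcal{V}^*$ on $\mathcal{L}$, and $\mathcal{R}(X):=\min_{t\in\mathbb{R}}\{t+\mathcal{V}(X-t)\}$ for $X\in\mathcal{M}$; suppose that $\mathcal{R}$ is finite valued on $\mathcal{M}$. For $\varepsilon\ge0$ let $\mathcal{R}^{\varepsilon}(X):=\inf_{\lambda>0}\{\lambda\varepsilon+\mathcal{R}_\lambda(X)\}$ with $\mathcal{R}_\lambda(X)=\lambda\mathcal{R}(\lambda^{-1}X)$. Let $\{\varepsilon_N\}\subset[0,+\infty)$ and let $\{M_N\}$ be random with $M_N\in\mathcal{M}$ a.s. Suppose that there exists $p_N\in\partial\mathcal{R}^{\varepsilon_N}(M_N)\cap\mathcal{L}$ a.s. for all $N$, that $\varepsilon_N\to\varepsilon\ge0$, and that $M_N\to M_\star$ in $\mathcal{M}$ a.s. Then any $\sigma(\mathcal{L},\mathcal{M})$-accumulation point $p_\star$ of the variational densities $\{p_N\}$ satisfies (almost surely) $$p_\star\in\partial\mathcal{R}^\varepsilon(M_\star)\cap\mathcal{L}.$$ In particular, $p_\star$ solves the asymptotic CGVI problem $\max_{p\in\mathfrak{D}_\varepsilon}\mathbb{E}[pM_\star]$.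
   Context: $(\Theta,\mathcal{B},\Pi)$ is a complete probability space and $\mathbb{E}$ is expectation with respect to $\Pi$. $\mathcal{L}$ and $\mathcal{M}$ are Banach spaces of ($\Pi$-a.s. equivalence classes of) $\mathcal{B}$-measurable functions $\Theta\to\mathbb{R}$, both containing all simple functions, such that $\mathbb{E}[|pX|]<\infty$ for all $p\in\mathcal{L}$, $X\in\mathcal{M}$. They are paired by $\langle p,X\rangle=\mathbb{E}[pX]$; through this pairing $\mathcal{L}$ is identified with a subspace of the topological dual $\mathcal{M}^*$ and $\mathcal{M}$ with a subspace of $\mathcal{L}^*$, and it is assumed that $\mathcal{L}=\mathcal{M}^*$ or $\mathcal{M}=\mathcal{L}^*$. $\sigma(\mathcal{M},\mathcal{L})$ and $\sigma(\mathcal{L},\mathcal{M})$ denote the weak topologies induced by the pairing. $\mathcal{V}:\mathcal{M}\to[-\infty,+\infty]$ is a risk-averse expected disutility function if: (V1) $\mathcal{V}$ is proper, $\sigma(\mathcal{M},\mathcal{L})$-lower semicontinuous and convex; (V2) $\mathcal{V}(X)\ge\mathbb{E}[X]$ for all $X\in\mathcal{M}$, with $\mathcal{V}(X)=\mathbb{E}[X]$ if and only if $X\equiv 0$; (V3) if $X,X'\in\mathcal{M}$ and $X\le X'$ a.s., then $\mathcal{V}(X)\le\mathcal{V}(X')$. $\Phi(p)=\mathcal{V}^*(p)=\sup_{X\in\mathcal{M}}\{\mathbb{E}[pX]-\mathcal{V}(X)\}$ for $p\in\mathcal{L}$. $\mathfrak{D}$ is the set of $\mathcal{B}$-measurable $p\ge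 0$ with $\mathbb{E}[p]=1$ and $\mathfrak{D}_\varepsilon=\{p\in\mathfrak{D}:\Phi(p)\le\varepsilon\}$, where $\Phi=+\infty$ for densities not in $\mathcal{L}$. $\partial f(x)=\{\eta\in\mathcal{M}^*: f(x')-f(x)\ge\langle\eta,x'-x\rangle\ \forall x'\in\mathcal{M}\}$ is the convex subdifferential. The pay-off functions $M_N$ depend on random data (e.g. $M_N(\theta)=\frac1N\sum_{n=1}^Nm(\theta,y_n)$ with realizations $y_n$ of $Y$), hence so do the $p_N$; "a.s." refers to the probability law of the data, so the conclusion is that for almost every realization every accumulation point of the corresponding sequence $\{p_N\}$ has the stated property. A $\sigma(\mathcal{L},\mathcal{M})$-accumulation point of a sequence in $\mathcal{L}$ is an element of $\mathcal{L}$ that is the $\sigma(\mathcal{L},\mathcal{M})$-limit of a subsequence. *)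

theory Defs
  imports "HOL-Probability.Probability"
begin

section \<open>Banach spaces of classes of measurable functions\<close>

text \<open>
  A Banach space of almost-sure equivalence classes of measurable functions on a measure space
  \<open>P\<close> is an arbitrary Banach space \<open>'b\<close> together with a map \<open>rep\<close> choosing for every element
  \<open>x\<close> of \<open>'b\<close> a representative \<open>rep x\<close> of the class it stands for. Hence \<open>rep\<close> is linear and
  injective only up to \<open>P\<close>-null sets. The representatives chosen are immaterial.
\<close>

definition class_in :: "'a measure \<Rightarrow> ('b \<Rightarrow> 'a \<Rightarrow> real) \<Rightarrow> ('a \<Rightarrow> real) \<Rightarrow> bool" where
  "class_in P rep f \<longleftrightarrow> (\<exists>x. AE \<theta> in P. rep x \<theta> = f \<theta>)"

definition class_of :: "'a measure \<Rightarrow> ('b \<Rightarrow> 'a \<Rightarrow> real) \<Rightarrow> ('a \<Rightarrow> real) \<Rightarrow> 'b" where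
  "class_of P rep f = (THE x. AE \<theta> in P. rep x \<theta> = f \<theta>)"

definition banach_function_space :: "'a measure \<Rightarrow> ('b::banach \<Rightarrow> 'a \<Rightarrow> real) \<Rightarrow> bool" where
  "banach_function_space P rep \<longleftrightarrow>
     (\<forall>x. rep x \<in> borel_measurable P) \<and>
     (\<forall>x y. AE \<theta> in P. rep (x + y) \<theta> = rep x \<theta> + rep y \<theta>) \<and>
     (\<forall>c x. AE \<theta> in P. rep (c *\<^sub>R x) \<theta> = c * rep x \<theta>) \<and>
     (\<forall>x y. (AE \<theta> in P. rep x \<theta> = rep y \<theta>) \<longrightarrow> x = y) \<and>
     (\<forall>f. simple_function P f \<longrightarrow> class_in P rep f)"

definition pairing ::
    "'a measure \<Rightarrow> ('l \<Rightarrow> 'a \<Rightarrow> real) \<Rightarrow> ('m \<Rightarrow> 'a \<Rightarrow> real) \<Rightarrow> 'l \<Rightarrow> 'm \<Rightarrow> real" where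
  "pairing P repL repM p X = (\<integral>\<theta>. repL p \<theta> * repM X \<theta> \<partial>P)"

text \<open>The identifications of \<open>'l\<close> with a subspace of the dual of \<open>'m\<close>, and conversely.\<close>

definition as_dual_M ::
    "'a measure \<Rightarrow> ('l \<Rightarrow> 'a \<Rightarrow> real) \<Rightarrow> ('m::banach \<Rightarrow> 'a \<Rightarrow> real) \<Rightarrow> 'l \<Rightarrow> ('m \<Rightarrow>\<^sub>L real)" where
  "as_dual_M P repL repM p = Blinfun (\<lambda>X. pairing P repL repM p X)"

definition as_dual_L ::
    "'a measure \<Rightarrow> ('l::banach \<Rightarrow> 'a \<Rightarrow> real) \<Rightarrow> ('m \<Rightarrow> 'a \<Rightarrow> real) \<Rightarrow> 'm \<Rightarrow> ('l \<Rightarrow>\<^sub>L real)" where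
  "as_dual_L P repL repM X = Blinfun (\<lambda>p. pairing P repL repM p X)"

locale paired_function_spaces = prob_space P + complete_measure P
  for P :: "'a measure" +
  fixes repL :: "'l::banach \<Rightarrow> 'a \<Rightarrow> real"
    and repM :: "'m::banach \<Rightarrow> 'a \<Rightarrow> real"
  assumes space_L: "banach_function_space P repL"
    and space_M: "banach_function_space P repM"
    and integrable_pairing: "\<And>p X. integrable P (\<lambda>\<theta>. repL p \<theta> * repM X \<theta>)"
    and continuous_on_M: "\<And>p. bounded_linear (\<lambda>X. pairing P repL repM p X)"
    and continuous_on_L: "\<And>X. bounded_linear (\<lambda>p. pairing P repL repM p X)"
    and duality: "range (as_dual_M P repL repM) = UNIV \<or> range (as_dual_L P repL repM) = UNIV"

section \<open>Weak topologies and extended-real-valued functions\<close>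

text \<open>The coarsest topology making every functional \<open>x \<mapsto> b i x\<close> continuous.\<close>

definition weak_topology :: "('i \<Rightarrow> 'b \<Rightarrow> real) \<Rightarrow> 'b topology" where
  "weak_topology b = topology_generated_by {{x. b i x \<in> U} | i U. open U}"

definition sigma_M_L ::
    "'a measure \<Rightarrow> ('l \<Rightarrow> 'a \<Rightarrow> real) \<Rightarrow> ('m \<Rightarrow> 'a \<Rightarrow> real) \<Rightarrow> 'm topology" where
  "sigma_M_L P repL repM = weak_topology (\<lambda>p X. pairing P repL repM p X)"

definition sigma_L_M ::
    "'a measure \<Rightarrow> ('l \<Rightarrow> 'a \<Rightarrow> real) \<Rightarrow> ('m \<Rightarrow> 'a \<Rightarrow> real) \<Rightarrow> 'l topology" where
  "sigma_L_M P repL repM = weak_topology (\<lambda>X p. pairing P repL repM p X)"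

definition seq_accumulation_point :: "'b topology \<Rightarrow> (nat \<Rightarrow> 'b) \<Rightarrow> 'b \<Rightarrow> bool" where
  "seq_accumulation_point T s x \<longleftrightarrow>
     (\<exists>r. strict_mono (r :: nat \<Rightarrow> nat) \<and> limitin T (s \<circ> r) x sequentially)"

definition ereal_lsc :: "'b topology \<Rightarrow> ('b \<Rightarrow> ereal) \<Rightarrow> bool" where
  "ereal_lsc T f \<longleftrightarrow> (\<forall>c. openin T {x \<in> topspace T. c < f x})"

definition ereal_proper :: "('b \<Rightarrow> ereal) \<Rightarrow> bool" where
  "ereal_proper f \<longleftrightarrow> (\<forall>x. f x \<noteq> -\<infinity>) \<and> (\<exists>x. f x \<noteq> \<infinity>)"

text \<open>Convexity through the epigraph, which avoids any convention for \<open>\<infinity> - \<infinity>\<close>.\<close>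

definition ereal_convex :: "('b::real_vector \<Rightarrow> ereal) \<Rightarrow> bool" where
  "ereal_convex f \<longleftrightarrow> convex {(x, r :: real). f x \<le> ereal r}"

definition subdifferential :: "('b::real_normed_vector \<Rightarrow> ereal) \<Rightarrow> 'b \<Rightarrow> ('b \<Rightarrow>\<^sub>L real) set" where
  "subdifferential f x =
     {\<eta>. \<forall>x'. f x' - f x \<ge> ereal (blinfun_apply \<eta> (x' - x))}"

section \<open>Disutility, risk and variational densities\<close>

definition risk_averse_disutility ::
    "'a measure \<Rightarrow> ('l \<Rightarrow> 'a \<Rightarrow> real) \<Rightarrow> ('m::banach \<Rightarrow> 'a \<Rightarrow> real) \<Rightarrow> ('m \<Rightarrow> ereal) \<Rightarrow> bool" where
  "risk_averse_disutility P repL repM V \<longleftrightarrow>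
     ereal_proper V \<and> ereal_lsc (sigma_M_L P repL repM) V \<and> ereal_convex V \<and>
     (\<forall>X. V X \<ge> ereal (\<integral>\<theta>. repM X \<theta> \<partial>P)) \<and>
     (\<forall>X. V X = ereal (\<integral>\<theta>. repM X \<theta> \<partial>P) \<longleftrightarrow> X = 0) \<and>
     (\<forall>X X'. (AE \<theta> in P. repM X \<theta> \<le> repM X' \<theta>) \<longrightarrow> V X \<le> V X')"

definition conj_disutility ::
    "'a measure \<Rightarrow> ('l \<Rightarrow> 'a \<Rightarrow> real) \<Rightarrow> ('m \<Rightarrow> 'a \<Rightarrow> real) \<Rightarrow> ('m \<Rightarrow> ereal) \<Rightarrow> 'l \<Rightarrow> ereal" where
  "conj_disutility P repL repM V p = (SUP X. ereal (pairing P repL repM p X) - V X)"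

text \<open>
  The minimum over \<open>t\<close> is rendered as an infimum in \<open>ereal\<close>; that it is attained is a
  consequence of the properties of \<open>V\<close> and not a further assumption.
\<close>

definition risk :: "'a measure \<Rightarrow> ('m \<Rightarrow> 'a \<Rightarrow> real) \<Rightarrow> ('m \<Rightarrow> ereal) \<Rightarrow> 'm \<Rightarrow> ereal" where
  "risk P repM V X = (INF t::real. ereal t + V (class_of P repM (\<lambda>\<theta>. repM X \<theta> - t)))"

definition scaled_risk ::
    "'a measure \<Rightarrow> ('m::banach \<Rightarrow> 'a \<Rightarrow> real) \<Rightarrow> ('m \<Rightarrow> ereal) \<Rightarrow> real \<Rightarrow> 'm \<Rightarrow> ereal" where
  "scaled_risk P repM V l X = ereal l * risk P repM V (inverse l *\<^sub>R X)"

definition eps_risk ::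
    "'a measure \<Rightarrow> ('m::banach \<Rightarrow> 'a \<Rightarrow> real) \<Rightarrow> ('m \<Rightarrow> ereal) \<Rightarrow> real \<Rightarrow> 'm \<Rightarrow> ereal" where
  "eps_risk P repM V e X = (INF l\<in>{0::real<..}. ereal (l * e) + scaled_risk P repM V l X)"

text \<open>
  Integrability of a density is implied: the integral of a non-integrable function is \<open>0\<close>.
\<close>

definition densities :: "'a measure \<Rightarrow> ('a \<Rightarrow> real) set" where
  "densities P = {f \<in> borel_measurable P. (AE \<theta> in P. 0 \<le> f \<theta>) \<and> (\<integral>\<theta>. f \<theta> \<partial>P) = 1}"

definition density_divergence ::
    "'a measure \<Rightarrow> ('l \<Rightarrow> 'a \<Rightarrow> real) \<Rightarrow> ('m \<Rightarrow> 'a \<Rightarrow> real) \<Rightarrow> ('m \<Rightarrow> ereal) \<Rightarrow>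
     ('a \<Rightarrow> real) \<Rightarrow> ereal" where
  "density_divergence P repL repM V f =
     (if class_in P repL f then conj_disutility P repL repM V (class_of P repL f) else \<infinity>)"

definition eps_densities ::
    "'a measure \<Rightarrow> ('l \<Rightarrow> 'a \<Rightarrow> real) \<Rightarrow> ('m \<Rightarrow> 'a \<Rightarrow> real) \<Rightarrow> ('m \<Rightarrow> ereal) \<Rightarrow>
     real \<Rightarrow> ('a \<Rightarrow> real) set" where
  "eps_densities P repL repM V e =
     {f \<in> densities P. density_divergence P repL repM V f \<le> ereal e}"

end

(*
  The envelope R^e is an infimum of perspectives, hence sublinear in X and, as an infimum of
  functions affine in e, concave and nondecreasing in e. For a sublinear function, p is a
  subgradient at M iff p <= R^e everywhere and R^e(M) <= <p, M>, and both inequalities pass to the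
  limit once R^e is Lipschitz in X locally uniformly in e. That bound follows from R being bounded
  above near 0, which the Baire category theorem gives for a finite-valued R.
  Finally, p <= R^e everywhere says exactly that p is a density with divergence at most e.
*)
theory Submission
  imports Defs
begin

section \<open>Infima of perspectives of a convex function\<close>

text \<open>Isolates what the limit argument uses of a risk measure: \<open>r\<close> stands for the
  risk and \<open>E\<close> for the expectation, its linear minorant. The local upper bound is what
  yields Lipschitz control.\<close>

locale convex_perspective =
  fixes r :: "'m::real_normed_vector \<Rightarrow> real" and E :: "'m \<Rightarrow> real"
  assumes convex_r: "convex_on UNIV r"
    and r_zero: "r 0 \<le> 0"
    and linear_E: "linear E"
    and E_le: "E X \<le> r X"
    and bdd_near_zero: "\<exists>d>0. \<exists>C. \<forall>X. norm X < d \<longrightarrow> r X \<le> C"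
begin

text \<open>For \<open>0 \<le> e\<close> the family is bounded below by \<open>E X\<close>, so that
  this real infimum is a genuine one.\<close>

definition env :: "real \<Rightarrow> 'm \<Rightarrow> real" where
  "env e X = (INF l\<in>{0<..}. l * e + l * r (inverse l *\<^sub>R X))"

lemma E_le_perspective:
  assumes "0 < l" "0 \<le> e"
  shows "E X \<le> l * e + l * r (inverse l *\<^sub>R X)"
proof -
  have "E X = l * E (inverse l *\<^sub>R X)"
    using assms by (simp add: linear_scale[OF linear_E])
  also have "\<dots> \<le> l * r (inverse l *\<^sub>R X)"
    using assms E_le by (intro mult_left_mono) auto
  also have "0 \<le> l * e" using assms by simp
  ultimately show ?thesis by linarith
qed

lemma env_le:
  assumes "0 < l" "0 \<le> e"
  shows "env e X \<le> l * e + l * r (inverse l *\<^sub>R X)"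
  unfolding env_def
proof (rule cINF_lower)
  show "bdd_below ((\<lambda>l. l * e + l * r (inverse l *\<^sub>R X)) ` {0<..})"
    using E_le_perspective[of _ e X] assms by (intro bdd_belowI2[of _ "E X"]) auto
qed (use assms in auto)

lemma env_greatest:
  assumes "\<And>l. 0 < l \<Longrightarrow> a \<le> l * e + l * r (inverse l *\<^sub>R X)"
  shows "a \<le> env e X"
  unfolding env_def using assms
  by (intro cINF_greatest) (auto intro: gt_ex)

lemma env_approx:
  assumes "a > env e X"
  obtains l where "0 < l" "l * e + l * r (inverse l *\<^sub>R X) < a"
  using assms env_greatest[of a e X] by (meson linorder_not_le)

text \<open>The perspective \<open>l * r (X / l)\<close> is jointly convex and positively
  homogeneous in \<open>(l, X)\<close>, hence jointly subadditive. Near-optimal scales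
  \<open>l\<close> for \<open>X\<close> and \<open>m\<close> for \<open>Y\<close> therefore combine
  to the scale \<open>l + m\<close> for \<open>X + Y\<close>.\<close>

lemma env_subadditive:
  assumes e: "0 \<le> e"
  shows "env e (X + Y) \<le> env e X + env e Y"
proof (rule field_le_epsilon)
  fix \<delta> :: real assume "0 < \<delta>"
  then have \<delta>: "env e Z < env e Z + \<delta>/2" for Z by simp
  obtain l where l: "0 < l" "l * e + l * r (inverse l *\<^sub>R X) < env e X + \<delta>/2"
    using env_approx[OF \<delta>] by blast
  obtain m where m: "0 < m" "m * e + m * r (inverse m *\<^sub>R Y) < env e Y + \<delta>/2"
    using env_approx[OF \<delta>] by blast
  have pos: "l + m > 0" using l m by simp
  \<comment> \<open>The weight for which the convex combination of \<open>X / l\<close> and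
    \<open>Y / m\<close> is \<open>(X + Y) / (l + m)\<close>.\<close>
  define t where "t = m / (l + m)"
  have t: "0 \<le> t" "t \<le> 1" "(l + m) * (1 - t) = l" "(l + m) * t = m"
    using l(1) m(1) by (auto simp: t_def field_simps)
  have inv: "(1 - t) * inverse l = inverse (l + m)" "t * inverse m = inverse (l + m)"
    using l(1) m(1) by (auto simp: t_def field_simps)
  have "inverse (l + m) *\<^sub>R (X + Y) = (1 - t) *\<^sub>R (inverse l *\<^sub>R X) + t *\<^sub>R (inverse m *\<^sub>R Y)"
    by (simp only: scaleR_scaleR inv scaleR_right_distrib)
  then have "r (inverse (l + m) *\<^sub>R (X + Y)) \<le> (1 - t) * r (inverse l *\<^sub>R X) + t * r (inverse m *\<^sub>R Y)"
    using convex_onD[OF convex_r t(1,2), of "inverse l *\<^sub>R X" "inverse m *\<^sub>R Y"]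
    by (simp only: UNIV_I)
  then have "(l + m) * r (inverse (l + m) *\<^sub>R (X + Y))
      \<le> (l + m) * ((1 - t) * r (inverse l *\<^sub>R X) + t * r (inverse m *\<^sub>R Y))"
    using pos by (intro mult_left_mono) auto
  also have "\<dots> = l * r (inverse l *\<^sub>R X) + m * r (inverse m *\<^sub>R Y)"
    by (simp only: distrib_left t(3,4) flip: mult.assoc)
  finally have "(l + m) * e + (l + m) * r (inverse (l + m) *\<^sub>R (X + Y)) \<le> env e X + env e Y + \<delta>"
    using l(2) m(2) by (simp add: distrib_right)
  then show "env e (X + Y) \<le> env e X + env e Y + \<delta>"
    using env_le[OF pos e, of "X + Y"] by linarith
qed

text \<open>Letting \<open>l\<close> tend to \<open>0\<close> removes the penalty
  \<open>l * e\<close>. This evaluates the envelope in directions where the risk grows at most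
  linearly, such as constants and nonpositive positions.\<close>

lemma env_le_small:
  assumes "0 \<le> e" "\<And>l. 0 < l \<Longrightarrow> r (inverse l *\<^sub>R X) \<le> a / l"
  shows "env e X \<le> a"
proof (rule field_le_epsilon)
  fix \<delta> :: real assume "0 < \<delta>"
  \<comment> \<open>The summand \<open>1\<close> keeps the denominator positive when
    \<open>e = 0\<close>.\<close>
  define l where "l = \<delta> / (e + 1)"
  have l: "0 < l" and le: "l * e \<le> \<delta>"
    using \<open>0 < \<delta>\<close> assms(1) by (auto simp: l_def field_simps)
  have "l * r (inverse l *\<^sub>R X) \<le> l * (a / l)"
    using assms(2) l by (intro mult_left_mono) auto
  then show "env e X \<le> a + \<delta>"
    using env_le[OF l assms(1), of X] le l by simp
qed

lemma env_zero: "0 \<le> e \<Longrightarrow> env e 0 \<le> 0"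
  using r_zero by (intro env_le_small) auto

lemma env_mono:
  assumes "0 \<le> e" "e \<le> e'"
  shows "env e X \<le> env e' X"
proof (rule env_greatest)
  fix l :: real assume l: "0 < l"
  have "l * e \<le> l * e'" using l assms by simp
  then show "env e X \<le> l * e' + l * r (inverse l *\<^sub>R X)"
    using env_le[OF l assms(1), of X] by linarith
qed

text \<open>Each member of the family is affine in \<open>e\<close>, so the infimum is concave; the
  segment from \<open>0\<close> to \<open>e\<close> is the one along which \<open>e\<close> is
  approached from below.\<close>

lemma env_concave_at_zero:
  assumes "0 \<le> e" "0 \<le> u" "u \<le> 1"
  shows "u * env e X + (1 - u) * env 0 X \<le> env (u * e) X"
proof (rule env_greatest)
  fix l :: real assume l: "0 < l"
  have "u * env e X \<le> u * (l * e + l * r (inverse l *\<^sub>R X))"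
    "(1 - u) * env 0 X \<le> (1 - u) * (l * 0 + l * r (inverse l *\<^sub>R X))"
    using env_le[OF l, of e X] env_le[OF l, of 0 X] assms by (auto intro!: mult_left_mono)
  then show "u * env e X + (1 - u) * env 0 X \<le> l * (u * e) + l * r (inverse l *\<^sub>R X)"
    by (simp add: algebra_simps)
qed

text \<open>A scale proportional to \<open>norm Z\<close> moves \<open>Z / l\<close> into the ball
  on which \<open>r\<close> is bounded. The resulting constant is affine in \<open>e\<close>, hence
  bounded along convergent sequences of radii.\<close>

lemma env_le_norm:
  obtains c C where "\<And>e Z. 0 \<le> e \<Longrightarrow> env e Z \<le> c * (e + C) * norm Z"
proof -
  obtain d C where d: "d > 0" and C: "\<And>X. norm X < d \<Longrightarrow> r X \<le> C"
    using bdd_near_zero by blast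
  show ?thesis
  proof
    fix e :: real and Z :: 'm assume e: "0 \<le> e"
    show "env e Z \<le> (2 / d) * (e + C) * norm Z"
    proof (cases "Z = 0")
      case True
      then show ?thesis using env_zero[OF e] by simp
    next
      case False
      \<comment> \<open>The factor \<open>2\<close> places \<open>Z / l\<close> at norm
        \<open>d / 2\<close>, strictly inside the ball.\<close>
      define l where "l = 2 * norm Z / d"
      have l: "0 < l" using False d by (simp add: l_def)
      have "norm (inverse l *\<^sub>R Z) = d / 2"
        using False d by (simp add: l_def field_simps)
      then have "l * r (inverse l *\<^sub>R Z) \<le> l * C"
        using C l d by (intro mult_left_mono) auto
      then have "env e Z \<le> l * (e + C)"
        using env_le[OF l e, of Z] by (simp add: distrib_left)
      then show ?thesis by (simp add: l_def field_simps)
    qed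
  qed
qed

text \<open>
  Being an infimum of functions affine in \<open>e\<close>, the envelope is upper semicontinuous in \<open>e\<close>, which
  gives the first part. The second needs lower semicontinuity, which comes from concavity in \<open>e\<close>
  (also at the end point \<open>0\<close>), and a Lipschitz bound in the argument that is uniform in \<open>e\<close>; the
  same bound controls \<open>q n (M n - M')\<close>.
\<close>

lemma support_limit:
  assumes lin: "\<And>n. linear (q n)"
    and q_le: "\<And>n X. q n X \<le> env (\<epsilon> n) X"
    and q_ge: "\<And>n. env (\<epsilon> n) (M n) \<le> q n (M n)"
    and e_nonneg: "\<And>n. 0 \<le> \<epsilon> n" and e: "\<epsilon> \<longlonglongrightarrow> e" and M: "M \<longlonglongrightarrow> M'"
    and q: "\<And>X. (\<lambda>n. q n X) \<longlonglongrightarrow> q' X"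
  shows "q' X \<le> env e X" and "env e M' \<le> q' M'"
proof -
  have e0: "0 \<le> e" using LIMSEQ_le_const[OF e] e_nonneg by blast
  show "q' X \<le> env e X"
  proof (rule env_greatest)
    fix l :: real assume l: "0 < l"
    have "(\<lambda>n. l * \<epsilon> n + l * r (inverse l *\<^sub>R X)) \<longlonglongrightarrow> l * e + l * r (inverse l *\<^sub>R X)"
      by (intro tendsto_intros e)
    then show "q' X \<le> l * e + l * r (inverse l *\<^sub>R X)"
      by (rule LIMSEQ_le[OF q]) (meson q_le env_le e_nonneg l order_trans)
  qed
  obtain c C where cC: "\<And>e Z. 0 \<le> e \<Longrightarrow> env e Z \<le> c * (e + C) * norm Z"
    using env_le_norm by blast
  \<comment> \<open>The largest factor in \<open>[0, 1]\<close> with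
    \<open>u n * e \<le> \<epsilon> n\<close>; monotonicity then bounds \<open>env (u n * e)\<close>
    by \<open>env (\<epsilon> n)\<close>, and concavity bounds it from below.\<close>
  define u where "u n = (if e = 0 then 1 else min 1 (\<epsilon> n / e))" for n
  have u: "u \<longlonglongrightarrow> 1"
  proof (cases "e = 0")
    case False
    have "(\<lambda>n. min 1 (\<epsilon> n / e)) \<longlonglongrightarrow> min 1 (e / e)"
      using False by (intro tendsto_intros e)
    then show ?thesis using False by (simp add: u_def[abs_def])
  qed (simp add: u_def[abs_def])
  have u01: "0 \<le> u n" "u n \<le> 1" and ue: "u n * e \<le> \<epsilon> n" for n
    using e0 e_nonneg[of n] by (auto simp: u_def min_def field_simps)
  \<comment> \<open>The error enters twice: once for moving the envelope from \<open>M'\<close> to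
    \<open>M n\<close>, once for moving \<open>q n\<close> back.\<close>
  have "u n * env e M' + (1 - u n) * env 0 M' - 2 * (c * (\<epsilon> n + C) * norm (M n - M')) \<le> q n M'" for n
  proof -
    have "u n * env e M' + (1 - u n) * env 0 M' \<le> env (u n * e) M'"
      using env_concave_at_zero e0 u01 by blast
    also have "\<dots> \<le> env (\<epsilon> n) M'"
      using env_mono ue u01 e0 by simp
    also have "\<dots> \<le> env (\<epsilon> n) (M' - M n) + env (\<epsilon> n) (M n)"
      using env_subadditive[OF e_nonneg, of n "M' - M n" "M n"] by simp
    also have "env (\<epsilon> n) (M' - M n) \<le> c * (\<epsilon> n + C) * norm (M n - M')"
      using cC[OF e_nonneg] by (metis norm_minus_commute)
    also have "env (\<epsilon> n) (M n) \<le> q n M' + q n (M n - M')"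
      using q_ge[of n] by (simp add: linear_diff[OF lin])
    also have "q n (M n - M') \<le> c * (\<epsilon> n + C) * norm (M n - M')"
      using q_le cC[OF e_nonneg] order_trans by blast
    finally show ?thesis by simp
  qed
  moreover have "(\<lambda>n. u n * env e M' + (1 - u n) * env 0 M' - 2 * (c * (\<epsilon> n + C) * norm (M n - M')))
      \<longlonglongrightarrow> 1 * env e M' + (1 - 1) * env 0 M' - 2 * (c * (e + C) * norm (M' - M'))"
    by (intro tendsto_intros e u M)
  ultimately show "env e M' \<le> q' M'"
    using LIMSEQ_le[OF _ q] by fastforce
qed

text \<open>Testing at \<open>X + Y\<close> and using subadditivity gives domination; testing at
  \<open>0\<close>, where the envelope is at most \<open>0\<close>, gives contact at
  \<open>X\<close>. Subtracting the two inequalities gives the converse.\<close>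

lemma subgradient_iff_support:
  assumes e: "0 \<le> e" and q: "linear q"
  shows "(\<forall>X'. q (X' - X) \<le> env e X' - env e X) \<longleftrightarrow> (\<forall>Y. q Y \<le> env e Y) \<and> env e X \<le> q X"
proof safe
  assume *: "\<forall>X'. q (X' - X) \<le> env e X' - env e X"
  show "q Y \<le> env e Y" for Y
    using *[rule_format, of "X + Y"] env_subadditive[OF e, of X Y] by simp
  show "env e X \<le> q X"
    using *[rule_format, of 0] env_zero[OF e] by (simp add: linear_neg[OF q])
qed (auto simp: linear_diff[OF q] intro: diff_mono)

end

section \<open>Boundedness of a finite-valued risk measure near the origin\<close>

text \<open>If all the closed sets had empty interior, so would their countable union, which is the
  whole space.\<close>

lemma Baire_countable_cover:
  fixes A :: "nat \<Rightarrow> 'b::{complete_space} set"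
  assumes "\<And>n. closed (A n)" "(\<Union>n. A n) = UNIV"
  obtains n where "interior (A n) \<noteq> {}"
proof -
  have "\<exists>n. interior (A n) \<noteq> {}"
  proof (rule ccontr)
    assume "\<not> ?thesis"
    then have "euclidean interior_of \<Union>(range A) = {}"
      using assms(1) completely_metrizable_space_euclidean
      by (intro Baire_category_alt) auto
    then show False using assms(2) by simp
  qed
  then show ?thesis using that by blast
qed


text \<open>Any small \<open>X\<close> is the midpoint of \<open>X0 + 2 X\<close>, which stays in a
  ball around \<open>X0\<close> inside \<open>A\<close>, and the fixed point \<open>- X0\<close>;
  convexity carries the bound from \<open>A\<close> to the origin.\<close>

lemma convex_bounded_above_near_zero:
  fixes r :: "'b::real_normed_vector \<Rightarrow> real"
  assumes r: "convex_on UNIV r" and A: "interior A \<noteq> {}" and le: "\<And>X. X \<in> A \<Longrightarrow> r X \<le> b"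
  shows "\<exists>d>0. \<exists>C. \<forall>X. norm X < d \<longrightarrow> r X \<le> C"
proof -
  obtain X0 d where d: "0 < d" "ball X0 d \<subseteq> A"
    using A by (metis all_not_in_conv mem_interior)
  have "r X \<le> b / 2 + r (- X0) / 2" if "norm X < d / 2" for X
  proof -
    have "X0 + 2 *\<^sub>R X \<in> A"
      using that d by (auto simp: dist_norm)
    moreover have "X = (1 - 1/2) *\<^sub>R (X0 + 2 *\<^sub>R X) + (1/2) *\<^sub>R (- X0)"
      by (simp add: algebra_simps)
    ultimately show ?thesis
      using convex_onD[OF r, of "1/2" "X0 + 2 *\<^sub>R X" "- X0"] le by fastforce
  qed
  then show ?thesis using d(1) by (metis half_gt_zero)
qed

section \<open>Weak topologies: comparison with the norm topology, and convergence of the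
  pairings\<close>

lemma openin_weak_topology_imp_open:
  fixes b :: "'i \<Rightarrow> 'b::topological_space \<Rightarrow> real"
  assumes "\<And>i. continuous_on UNIV (b i)" "openin (weak_topology b) S"
  shows "open S"
proof -
  have "generate_topology_on {{x. b i x \<in> U} | i U. open U} S"
    using assms(2) unfolding weak_topology_def by (rule openin_topology_generated_by)
  then show ?thesis
  proof induction
    case (Basis s)
    then obtain i U where "open U" "s = b i -` U" by (auto simp: vimage_def)
    then show ?case using assms(1) by (auto intro: open_vimage)
  qed auto
qed

lemma limitin_weak_topology_imp_tendsto:
  assumes "limitin (weak_topology b) s x F"
  shows "((\<lambda>n. b i (s n)) \<longlongrightarrow> b i x) F"
proof (rule topological_tendstoI)
  fix U :: "real set" assume U: "open U" "b i x \<in> U"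
  have "openin (weak_topology b) {x. b i x \<in> U}"
    unfolding weak_topology_def using U by (intro topology_generated_by_Basis) auto
  then show "eventually (\<lambda>n. b i (s n) \<in> U) F"
    using assms U by (auto simp: limitin_def)
qed

section \<open>Almost-sure classes and their representatives\<close>

lemma banach_function_space_simps:
  assumes "banach_function_space P rep"
  shows rep_measurable: "rep x \<in> borel_measurable P"
    and rep_add: "AE \<theta> in P. rep (x + y) \<theta> = rep x \<theta> + rep y \<theta>"
    and rep_scaleR: "AE \<theta> in P. rep (c *\<^sub>R x) \<theta> = c * rep x \<theta>"
    and rep_inject: "(AE \<theta> in P. rep x \<theta> = rep y \<theta>) \<Longrightarrow> x = y"
    and simple_class_in: "simple_function P f \<Longrightarrow> class_in P rep f"
  using assms unfolding banach_function_space_def by blast+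

lemma class_of_eqI:
  assumes "banach_function_space P rep" "AE \<theta> in P. rep x \<theta> = f \<theta>"
  shows "class_of P rep f = x"
  unfolding class_of_def
proof (rule the_equality)
  show "y = x" if "AE \<theta> in P. rep y \<theta> = f \<theta>" for y
  proof (rule rep_inject[OF assms(1)])
    show "AE \<theta> in P. rep y \<theta> = rep x \<theta>"
      using that assms(2) by eventually_elim simp
  qed
qed (fact assms(2))

lemma class_of_AE:
  assumes "banach_function_space P rep" "class_in P rep f"
  shows "AE \<theta> in P. rep (class_of P rep f) \<theta> = f \<theta>"
  using assms class_of_eqI unfolding class_in_def by metis

lemma AE_rep_zero:
  assumes "banach_function_space P rep"
  shows "AE \<theta> in P. rep 0 \<theta> = 0"
  using rep_scaleR[OF assms, of 0 0] by simp

section \<open>The risk measure as a finite convex function on the Banach space\<close>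

locale finite_risk_disutility = paired_function_spaces P repL repM
  for P :: "'a measure" and repL :: "'l::banach \<Rightarrow> 'a \<Rightarrow> real"
    and repM :: "'m::banach \<Rightarrow> 'a \<Rightarrow> real" +
  fixes V :: "'m \<Rightarrow> ereal"
  assumes disutility: "risk_averse_disutility P repL repM V"
    and finite_risk: "\<bar>risk P repM V X\<bar> \<noteq> \<infinity>"
begin

text \<open>Represents the constants inside the space, so that the shift by \<open>t\<close> in the
  risk becomes the vector operation \<open>X - t *\<^sub>R one\<close>.\<close>

definition one :: 'm where "one = class_of P repM (\<lambda>_. 1)"

definition expect :: "'m \<Rightarrow> real" where "expect X = (\<integral>\<theta>. repM X \<theta> \<partial>P)"

definition rho :: "'m \<Rightarrow> real" where "rho X = real_of_ereal (risk P repM V X)"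

abbreviation pair :: "'l \<Rightarrow> 'm \<Rightarrow> real" where "pair \<equiv> pairing P repL repM"

lemma rep_one: "AE \<theta> in P. repM one \<theta> = 1"
  unfolding one_def by (intro class_of_AE space_M simple_class_in[OF space_M]) simp

lemma rep_shift: "AE \<theta> in P. repM (X - t *\<^sub>R one) \<theta> = repM X \<theta> - t"
  using rep_add[OF space_M, of X "(- t) *\<^sub>R one"] rep_scaleR[OF space_M, of "- t" one] rep_one
  by eventually_elim simp

lemma class_of_shift: "class_of P repM (\<lambda>\<theta>. repM X \<theta> - t) = X - t *\<^sub>R one"
  by (intro class_of_eqI space_M rep_shift)

lemma risk_eq: "risk P repM V X = (INF t. ereal t + V (X - t *\<^sub>R one))"
  unfolding risk_def class_of_shift ..

lemma ereal_rho: "ereal (rho X) = risk P repM V X"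
  unfolding rho_def using finite_risk by (simp add: ereal_real)

text \<open>The constant \<open>1\<close> is simple, hence has a class in the dual partner, and
  pairing with it is integration.\<close>

lemma integrable_repM: "integrable P (repM X)"
proof -
  obtain q where q: "AE \<theta> in P. repL q \<theta> = 1"
    using simple_class_in[OF space_L, of "\<lambda>_. 1"] by (auto simp: class_in_def)
  have "integrable P (repM X) = integrable P (\<lambda>\<theta>. repL q \<theta> * repM X \<theta>)"
    using q rep_measurable[OF space_L] rep_measurable[OF space_M]
    by (intro integrable_cong_AE) auto
  then show ?thesis using integrable_pairing by simp
qed

lemma linear_expect: "linear expect"
proof (rule linearI)
  fix X Y :: 'm and c :: real
  have "expect (X + Y) = (\<integral>\<theta>. repM X \<theta> + repM Y \<theta> \<partial>P)"
    unfolding expect_def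
    using rep_add[OF space_M] rep_measurable[OF space_M]
    by (intro integral_cong_AE borel_measurable_add) auto
  then show "expect (X + Y) = expect X + expect Y"
    by (simp add: expect_def integrable_repM)
  have "expect (c *\<^sub>R X) = (\<integral>\<theta>. c * repM X \<theta> \<partial>P)"
    unfolding expect_def
    using rep_scaleR[OF space_M] rep_measurable[OF space_M]
    by (intro integral_cong_AE borel_measurable_times borel_measurable_const) auto
  then show "expect (c *\<^sub>R X) = c *\<^sub>R expect X"
    by (simp add: expect_def)
qed

lemma expect_one: "expect one = 1"
proof -
  have "expect one = (\<integral>\<theta>. 1 \<partial>P)"
    unfolding expect_def using rep_one rep_measurable[OF space_M]
    by (intro integral_cong_AE) auto
  then show ?thesis by (simp add: prob_space)
qed

lemma linear_pair: "linear (pair q)"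
  using continuous_on_M bounded_linear.linear by blast

lemma pair_one: "pair q one = (\<integral>\<theta>. repL q \<theta> \<partial>P)"
  unfolding pairing_def using rep_one rep_measurable[OF space_L] rep_measurable[OF space_M]
  by (intro integral_cong_AE) auto

lemma as_dual_M_apply: "blinfun_apply (as_dual_M P repL repM q) X = pair q X"
  unfolding as_dual_M_def by (simp add: bounded_linear_Blinfun_apply continuous_on_M)

lemma expect_le_V: "ereal (expect X) \<le> V X"
  and V_zero: "V 0 = 0"
  and V_mono: "(AE \<theta> in P. repM X \<theta> \<le> repM Y \<theta>) \<Longrightarrow> V X \<le> V Y"
proof -
  show "ereal (expect X) \<le> V X"
    using disutility unfolding risk_averse_disutility_def expect_def by blast
  have "V 0 = ereal (expect 0)"
    using disutility unfolding risk_averse_disutility_def expect_def by blast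
  then show "V 0 = 0" by (simp add: linear_0[OF linear_expect])
  show "(AE \<theta> in P. repM X \<theta> \<le> repM Y \<theta>) \<Longrightarrow> V X \<le> V Y"
    using disutility unfolding risk_averse_disutility_def by blast
qed

lemma V_convex:
  assumes "V X \<le> ereal a" "V Y \<le> ereal b" "0 \<le> u" "u \<le> 1"
  shows "V ((1 - u) *\<^sub>R X + u *\<^sub>R Y) \<le> ereal ((1 - u) * a + u * b)"
proof -
  have "convex {(X, a :: real). V X \<le> ereal a}"
    using disutility unfolding risk_averse_disutility_def ereal_convex_def by blast
  from convexD_alt[OF this, of "(X, a)" "(Y, b)" u] assms show ?thesis by simp
qed

text \<open>The pairings are norm continuous, so weakly open sets are norm open and weak lower
  semicontinuity of \<open>V\<close> passes to the norm. Norm closedness is what the Baire argument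
  requires.\<close>

lemma closed_V_sublevel: "closed {X. V X \<le> ereal c}"
proof -
  let ?T = "weak_topology (\<lambda>q X. pair q X)"
  have "ereal_lsc ?T V"
    using disutility unfolding risk_averse_disutility_def sigma_M_L_def by blast
  moreover have top: "topspace ?T = UNIV"
  proof -
    \<comment> \<open>The carrier of a generated topology is the union of its generators; the choice
      \<open>U = UNIV\<close> makes it everything.\<close>
    have "{x. pair q x \<in> UNIV} \<in> {{x. pair i x \<in> U} | i U. open U}" for q
      by blast
    then show ?thesis unfolding weak_topology_def by auto
  qed
  ultimately have "openin ?T {X. ereal c < V X}"
    unfolding ereal_lsc_def by simp
  then have "open {X. ereal c < V X}"
    by (rule openin_weak_topology_imp_open[rotated])
      (intro linear_continuous_on continuous_on_M)
  moreover have "- {X. V X \<le> ereal c} = {X. ereal c < V X}" by auto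
  ultimately show ?thesis by (simp add: closed_def)
qed

lemma rho_le:
  assumes "V (X - t *\<^sub>R one) \<le> ereal (a - t)"
  shows "rho X \<le> a"
proof -
  have "ereal (rho X) \<le> ereal t + V (X - t *\<^sub>R one)"
    unfolding ereal_rho risk_eq by (rule INF_lower) simp
  also have "\<dots> \<le> ereal t + ereal (a - t)"
    using assms by (intro add_left_mono)
  finally show ?thesis by simp
qed

text \<open>A near-optimal shift, in the real-valued form that convexity of \<open>V\<close> and
  \<open>rho_le\<close> can consume; it stands in for the minimiser.\<close>

lemma rho_approx:
  assumes "rho X < a"
  obtains t where "V (X - t *\<^sub>R one) \<le> ereal (a - t)"
proof -
  have "(INF t. ereal t + V (X - t *\<^sub>R one)) < ereal a"
    using assms by (simp flip: risk_eq ereal_rho)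
  then obtain t where "ereal t + V (X - t *\<^sub>R one) < ereal a"
    by (auto simp: INF_less_iff)
  then have "V (X - t *\<^sub>R one) \<le> ereal (a - t)"
    by (cases "V (X - t *\<^sub>R one)") auto
  then show ?thesis by (rule that)
qed

lemma rho_greatest:
  assumes "\<And>t. ereal (a - t) \<le> V (X - t *\<^sub>R one)"
  shows "a \<le> rho X"
proof (rule field_le_epsilon)
  fix \<delta> :: real assume "0 < \<delta>"
  then obtain t where "V (X - t *\<^sub>R one) \<le> ereal (rho X + \<delta> - t)"
    using rho_approx[of X "rho X + \<delta>"] by auto
  with assms[of t] have "ereal (a - t) \<le> ereal (rho X + \<delta> - t)"
    by (rule order_trans)
  then show "a \<le> rho X + \<delta>" by simp
qed

lemma expect_le_rho: "expect X \<le> rho X"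
proof (rule rho_greatest)
  show "ereal (expect X - t) \<le> V (X - t *\<^sub>R one)" for t
    using expect_le_V[of "X - t *\<^sub>R one"]
    by (simp add: linear_diff[OF linear_expect] linear_scale[OF linear_expect] expect_one)
qed

text \<open>Partial minimisation over \<open>t\<close> of the jointly convex function
  \<open>t + V (X - t *\<^sub>R one)\<close>; near-optimal shifts \<open>s\<close> and
  \<open>t\<close> mix with the same weights as \<open>X\<close> and \<open>Y\<close>.\<close>

lemma rho_convex: "convex_on UNIV rho"
proof
  fix u :: real and X Y :: 'm assume u: "0 < u" "u < 1"
  show "rho ((1 - u) *\<^sub>R X + u *\<^sub>R Y) \<le> (1 - u) * rho X + u * rho Y"
  proof (rule field_le_epsilon)
    fix \<delta> :: real assume \<delta>: "0 < \<delta>"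
    then have *: "rho Z < rho Z + \<delta>" for Z by simp
    obtain s where s: "V (X - s *\<^sub>R one) \<le> ereal (rho X + \<delta> - s)"
      using rho_approx[OF *] by blast
    obtain t where t: "V (Y - t *\<^sub>R one) \<le> ereal (rho Y + \<delta> - t)"
      using rho_approx[OF *] by blast
    from V_convex[OF s t, of u] u
    have *: "V ((1 - u) *\<^sub>R (X - s *\<^sub>R one) + u *\<^sub>R (Y - t *\<^sub>R one))
        \<le> ereal ((1 - u) * (rho X + \<delta> - s) + u * (rho Y + \<delta> - t))"
      by simp
    have "(1 - u) *\<^sub>R (X - s *\<^sub>R one) + u *\<^sub>R (Y - t *\<^sub>R one)
        = ((1 - u) *\<^sub>R X + u *\<^sub>R Y) - ((1 - u) * s + u * t) *\<^sub>R one"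
      by (simp add: algebra_simps)
    moreover have "(1 - u) * (rho X + \<delta> - s) + u * (rho Y + \<delta> - t)
        = ((1 - u) * rho X + u * rho Y + \<delta>) - ((1 - u) * s + u * t)"
      by (simp add: algebra_simps)
    ultimately show "rho ((1 - u) *\<^sub>R X + u *\<^sub>R Y) \<le> (1 - u) * rho X + u * rho Y + \<delta>"
      using * by (metis rho_le)
  qed
qed simp

text \<open>
  The sets \<open>{V \<le> n} + [-n, n]\<close> are closed, being sums of a closed and a compact set, and cover the
  Banach space because \<open>rho\<close> is finite; on each of them \<open>rho\<close> is bounded above.
\<close>

lemma rho_bounded_near_zero: "\<exists>d>0. \<exists>C. \<forall>X. norm X < d \<longrightarrow> rho X \<le> C"
proof -
  define A where "A n = (\<Union>X\<in>{X. V X \<le> ereal (real n)}. \<Union>Y\<in>(\<lambda>t. t *\<^sub>R one) ` {- real n..real n}. {X + Y})"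
    for n :: nat
  have "closed (A n)" for n
    unfolding A_def
    by (intro closed_compact_sums closed_V_sublevel compact_continuous_image continuous_intros) auto
  moreover have "(\<Union>n. A n) = UNIV"
  proof -
    have "\<exists>n. X \<in> A n" for X
    proof -
      obtain t where t: "V (X - t *\<^sub>R one) \<le> ereal (rho X + 1 - t)"
        using rho_approx[of X "rho X + 1"] by auto
      obtain n :: nat where n: "max (rho X + 1 - t) \<bar>t\<bar> \<le> real n"
        using real_arch_simple by blast
      then have "V (X - t *\<^sub>R one) \<le> ereal (real n)" "t \<in> {- real n..real n}"
        using order_trans[OF t, of "ereal (real n)"] by auto
      then have "X \<in> A n"
        unfolding A_def by (intro UN_I[of "X - t *\<^sub>R one"] UN_I[of "t *\<^sub>R one"]) auto
      then show ?thesis by blast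
    qed
    then show ?thesis by blast
  qed
  ultimately obtain n where "interior (A n) \<noteq> {}"
    using Baire_countable_cover by blast
  \<comment> \<open>The shift in the decomposition of \<open>X\<close> is a candidate in the
    infimum, with value \<open>t + V Y \<le> n + n\<close>.\<close>
  moreover have "rho X \<le> 2 * real n" if X: "X \<in> A n" for X
  proof -
    obtain Y t where Y: "X = Y + t *\<^sub>R one" "V Y \<le> ereal (real n)" "t \<le> real n"
      using X unfolding A_def by auto
    have "V Y \<le> ereal (2 * real n - t)"
      using Y(2) by (rule order_trans) (use Y(3) in simp)
    then show ?thesis using Y(1) by (intro rho_le[of _ t]) simp
  qed
  ultimately show ?thesis
    using convex_bounded_above_near_zero[OF rho_convex] by blast
qed

section \<open>The envelope of the risk measure and its subdifferential\<close>

sublocale convex_perspective rho expect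
proof
  show "rho 0 \<le> 0" by (rule rho_le[of _ 0]) (simp add: V_zero)
qed (simp_all add: rho_convex expect_le_rho rho_bounded_near_zero
    linear_add[OF linear_expect] linear_scale[OF linear_expect])

lemma eps_risk_eq:
  assumes e: "0 \<le> e"
  shows "eps_risk P repM V e X = ereal (env e X)"
proof -
  have "eps_risk P repM V e X = (INF l\<in>{0<..}. ereal (l * e + l * rho (inverse l *\<^sub>R X)))"
    unfolding eps_risk_def scaled_risk_def by (simp flip: ereal_rho)
  also have "\<dots> = ereal (env e X)"
  proof (rule antisym)
    show "(INF l\<in>{0<..}. ereal (l * e + l * rho (inverse l *\<^sub>R X))) \<le> ereal (env e X)"
    proof (rule ereal_le_epsilon2)
      fix \<delta> :: real assume "0 < \<delta>"
      then obtain l where l: "0 < l" "l * e + l * rho (inverse l *\<^sub>R X) < env e X + \<delta>"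
        using env_approx[of e X "env e X + \<delta>"] by auto
      then show "(INF l\<in>{0<..}. ereal (l * e + l * rho (inverse l *\<^sub>R X))) \<le> ereal (env e X) + ereal \<delta>"
        by (intro INF_lower2[of l]) auto
    qed
    show "ereal (env e X) \<le> (INF l\<in>{0<..}. ereal (l * e + l * rho (inverse l *\<^sub>R X)))"
      using env_le e by (intro INF_greatest) auto
  qed
  finally show ?thesis .
qed

lemma subdifferential_iff:
  assumes e: "0 \<le> e"
  shows "as_dual_M P repL repM q \<in> subdifferential (eps_risk P repM V e) X
    \<longleftrightarrow> (\<forall>Y. pair q Y \<le> env e Y) \<and> env e X \<le> pair q X"
  unfolding subgradient_iff_support[OF e linear_pair, symmetric]
  by (simp add: subdifferential_def eps_risk_eq[OF e] as_dual_M_apply)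

section \<open>Densities in the divergence ball\<close>

text \<open>Fenchel-Young at \<open>X / l - t *\<^sub>R one\<close>: unit mass makes the shift by
  \<open>t\<close> cancel, so the bound survives the infimum over \<open>t\<close>; multiplying by
  \<open>l\<close> gives a bound for every scale.\<close>

lemma conj_le_imp_pair_le_env:
  assumes e: "0 \<le> e" and one: "pair q one = 1"
    and conj: "conj_disutility P repL repM V q \<le> ereal e"
  shows "pair q X \<le> env e X"
proof (rule env_greatest)
  fix l :: real assume l: "0 < l"
  have V_ge: "ereal (pair q Y - e) \<le> V Y" for Y
  proof -
    have "ereal (pair q Y) - V Y \<le> conj_disutility P repL repM V q"
      unfolding conj_disutility_def by (rule SUP_upper) simp
    then have "ereal (pair q Y) - V Y \<le> ereal e"
      using conj by (rule order_trans)
    \<comment> \<open>The expectation bound excludes the value \<open>-\<infinity>\<close> of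
      \<open>V Y\<close>.\<close>
    then show ?thesis
      using expect_le_V[of Y] by (cases "V Y") auto
  qed
  have "pair q (inverse l *\<^sub>R X) - e \<le> rho (inverse l *\<^sub>R X)"
  proof (rule rho_greatest)
    fix t
    show "ereal (pair q (inverse l *\<^sub>R X) - e - t) \<le> V (inverse l *\<^sub>R X - t *\<^sub>R one)"
      using V_ge[of "inverse l *\<^sub>R X - t *\<^sub>R one"] one
      by (simp add: linear_diff[OF linear_pair] linear_scale[OF linear_pair] algebra_simps)
  qed
  then have "l * (pair q (inverse l *\<^sub>R X) - e) \<le> l * rho (inverse l *\<^sub>R X)"
    using l by (intro mult_left_mono) auto
  moreover have "l * pair q (inverse l *\<^sub>R X) = pair q X"
    using l by (simp add: linear_scale[OF linear_pair])
  ultimately show "pair q X \<le> l * e + l * rho (inverse l *\<^sub>R X)"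
    by (simp add: right_diff_distrib)
qed

text \<open>The scale \<open>l = 1\<close> and the shift \<open>t = 0\<close> give
  \<open>pair q X \<le> e + rho X \<le> e + V X\<close>.\<close>

lemma conj_le_of_pair_le_env:
  assumes e: "0 \<le> e" and le: "\<And>X. pair q X \<le> env e X"
  shows "conj_disutility P repL repM V q \<le> ereal e"
  unfolding conj_disutility_def
proof (rule SUP_least)
  fix X
  show "ereal (pair q X) - V X \<le> ereal e"
  proof (cases "V X")
    case (real v)
    have "rho X \<le> v" by (rule rho_le[of _ 0]) (simp add: real)
    then show ?thesis
      using le[of X] env_le[of 1 e X] e real by simp
  qed (use expect_le_V[of X] in auto)
qed

text \<open>The test element is minus the indicator of \<open>{q < 0}\<close>. Monotonicity of
  \<open>V\<close> makes its envelope at most \<open>0\<close>, while its product with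
  \<open>q\<close> is nonnegative, so that product vanishes almost everywhere.\<close>

lemma pair_le_env_imp_nonneg:
  assumes e: "0 \<le> e" and le: "\<And>X. pair q X \<le> env e X"
  shows "AE \<theta> in P. 0 \<le> repL q \<theta>"
proof -
  note [measurable] = rep_measurable[OF space_L, of q]
  define f where "f \<theta> = (if repL q \<theta> < 0 then - 1 else 0 :: real)" for \<theta>
  have f: "simple_function P f"
    unfolding f_def by (intro simple_function_If) auto
  define X where "X = class_of P repM f"
  have X: "AE \<theta> in P. repM X \<theta> = f \<theta>"
    unfolding X_def by (intro class_of_AE space_M simple_class_in[OF space_M] f)
  have "env e X \<le> 0"
  proof (rule env_le_small[OF e])
    fix l :: real assume l: "0 < l"
    have "AE \<theta> in P. repM (inverse l *\<^sub>R X) \<theta> \<le> repM 0 \<theta>"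
      using X rep_scaleR[OF space_M, of "inverse l" X] AE_rep_zero[OF space_M]
      by eventually_elim (use l in \<open>auto simp: f_def\<close>)
    then show "rho (inverse l *\<^sub>R X) \<le> 0 / l"
      using rho_le[of _ 0 0] V_mono[of _ 0] V_zero by (simp add: zero_ereal_def)
  qed
  then have "pair q X \<le> 0" using le order_trans by blast
  moreover have "AE \<theta> in P. 0 \<le> repL q \<theta> * repM X \<theta>"
    using X by eventually_elim (auto simp: f_def)
  ultimately have "(\<integral>\<theta>. repL q \<theta> * repM X \<theta> \<partial>P) = 0"
    unfolding pairing_def by (simp add: antisym integral_nonneg_AE)
  then have "AE \<theta> in P. repL q \<theta> * repM X \<theta> = 0"
    using integral_nonneg_eq_0_iff_AE[OF integrable_pairing] \<open>AE \<theta> in P. 0 \<le> repL q \<theta> * repM X \<theta>\<close>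
    by blast
  then show ?thesis
    using X by eventually_elim (auto simp: f_def split: if_splits)
qed

text \<open>On constants the shift \<open>t = c / l\<close> leaves the argument \<open>0\<close>,
  where \<open>V\<close> vanishes; the multiples \<open>c = 1\<close> and \<open>c = -1\<close> give
  the two inequalities.\<close>

lemma pair_le_env_imp_pair_one:
  assumes e: "0 \<le> e" and le: "\<And>X. pair q X \<le> env e X"
  shows "pair q one = 1"
proof -
  have "pair q (c *\<^sub>R one) \<le> c" for c
  proof -
    have "env e (c *\<^sub>R one) \<le> c"
    proof (rule env_le_small[OF e])
      fix l :: real assume "0 < l"
      show "rho (inverse l *\<^sub>R c *\<^sub>R one) \<le> c / l"
        by (rule rho_le[of _ "c / l"]) (simp add: V_zero divide_inverse mult.commute)
    qed
    then show ?thesis using le order_trans by blast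
  qed
  from this[of 1] this[of "-1"] show ?thesis
    by (simp add: linear_neg[OF linear_pair])
qed

lemma eps_density_iff:
  assumes e: "0 \<le> e"
  shows "repL q \<in> eps_densities P repL repM V e \<longleftrightarrow> (\<forall>X. pair q X \<le> env e X)"
proof -
  have "class_of P repL (repL q) = q" "class_in P repL (repL q)"
    using class_of_eqI[OF space_L] by (auto simp: class_in_def)
  then have "repL q \<in> eps_densities P repL repM V e \<longleftrightarrow>
      (AE \<theta> in P. 0 \<le> repL q \<theta>) \<and> pair q one = 1 \<and> conj_disutility P repL repM V q \<le> ereal e"
    by (auto simp: eps_densities_def densities_def density_divergence_def pair_one
        rep_measurable[OF space_L])
  then show ?thesis
    using conj_le_imp_pair_le_env conj_le_of_pair_le_env pair_le_env_imp_nonneg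
      pair_le_env_imp_pair_one e by blast
qed

text \<open>The divergence ball consists of functions, not classes. Since the divergence is infinite
  outside the space, a finite bound lets \<open>f\<close> be replaced by a representative equal to
  it almost surely.\<close>

lemma eps_densityE:
  assumes "f \<in> eps_densities P repL repM V e"
  obtains q where "AE \<theta> in P. repL q \<theta> = f \<theta>" "repL q \<in> eps_densities P repL repM V e"
proof -
  have f: "f \<in> borel_measurable P" "AE \<theta> in P. 0 \<le> f \<theta>" "(\<integral>\<theta>. f \<theta> \<partial>P) = 1"
    "density_divergence P repL repM V f \<le> ereal e"
    using assms by (auto simp: eps_densities_def densities_def)
  then have cl: "class_in P repL f"
    by (auto simp: density_divergence_def split: if_splits)
  define q where "q = class_of P repL f"
  have q: "AE \<theta> in P. repL q \<theta> = f \<theta>"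
    unfolding q_def by (rule class_of_AE[OF space_L cl])
  have "(\<integral>\<theta>. repL q \<theta> \<partial>P) = 1"
    using f q rep_measurable[OF space_L] integral_cong_AE by metis
  moreover have "AE \<theta> in P. 0 \<le> repL q \<theta>"
    using q f(2) by eventually_elim simp
  moreover have "class_in P repL (repL q)" "class_of P repL (repL q) = q"
    using class_of_eqI[OF space_L] by (auto simp: class_in_def)
  ultimately have "repL q \<in> eps_densities P repL repM V e"
    using f(4) cl
    by (auto simp: eps_densities_def densities_def density_divergence_def q_def
        rep_measurable[OF space_L])
  then show ?thesis using q that by blast
qed

text \<open>The value \<open>env e X\<close> bounds the objective on the whole ball, and
  \<open>q\<close> attains it.\<close>

lemma subgradient_is_arg_max:
  assumes e: "0 \<le> e" and q: "\<And>Y. pair q Y \<le> env e Y" "env e X \<le> pair q X"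
  shows "is_arg_max (\<lambda>f. \<integral>\<theta>. f \<theta> * repM X \<theta> \<partial>P)
    (\<lambda>f. f \<in> eps_densities P repL repM V e) (repL q)"
proof -
  have "(\<integral>\<theta>. f \<theta> * repM X \<theta> \<partial>P) \<le> pair q X" if f: "f \<in> eps_densities P repL repM V e" for f
  proof -
    obtain q' where q': "AE \<theta> in P. repL q' \<theta> = f \<theta>" "repL q' \<in> eps_densities P repL repM V e"
      using eps_densityE[OF f] by blast
    have "f \<in> borel_measurable P" using f by (simp add: eps_densities_def densities_def)
    then have "(\<integral>\<theta>. f \<theta> * repM X \<theta> \<partial>P) = pair q' X"
      unfolding pairing_def using q'(1) rep_measurable[OF space_L] rep_measurable[OF space_M]
      by (intro integral_cong_AE) auto
    also have "\<dots> \<le> env e X" using q'(2) eps_density_iff[OF e] by blast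
    finally show ?thesis using q(2) by linarith
  qed
  then show ?thesis
    using eps_density_iff[OF e] q(1) by (auto simp: is_arg_max_def pairing_def not_less)
qed

end

section \<open>Passage to the limit for almost every realization of the data\<close>

theorem theorem15:
  fixes P :: "'a measure"
    and repL :: "'l::banach \<Rightarrow> 'a \<Rightarrow> real"
    and repM :: "'m::banach \<Rightarrow> 'a \<Rightarrow> real"
    and V :: "'m \<Rightarrow> ereal"
    and \<Omega> :: "'w measure"
    and eps :: "nat \<Rightarrow> real" and e :: real
    and M :: "nat \<Rightarrow> 'w \<Rightarrow> 'a \<Rightarrow> real" and Mstar :: "'w \<Rightarrow> 'm"
    and p :: "nat \<Rightarrow> 'w \<Rightarrow> 'l"
  assumes spaces: "paired_function_spaces P repL repM"
    and V: "risk_averse_disutility P repL repM V"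
    and finite_risk: "\<And>X. \<bar>risk P repM V X\<bar> \<noteq> \<infinity>"
    and data: "prob_space \<Omega>"
    and eps_nonneg: "\<And>N. 0 \<le> eps N"
    and M_in: "\<And>N. AE \<omega> in \<Omega>. class_in P repM (M N \<omega>)"
    and p_sub: "\<And>N. AE \<omega> in \<Omega>. as_dual_M P repL repM (p N \<omega>)
                  \<in> subdifferential (eps_risk P repM V (eps N)) (class_of P repM (M N \<omega>))"
    and eps_lim: "eps \<longlonglongrightarrow> e" and e_nonneg: "0 \<le> e"
    and M_lim: "AE \<omega> in \<Omega>. (\<lambda>N. class_of P repM (M N \<omega>)) \<longlonglongrightarrow> Mstar \<omega>"
  shows "AE \<omega> in \<Omega>. \<forall>pstar.
           seq_accumulation_point (sigma_L_M P repL repM) (\<lambda>N. p N \<omega>) pstar \<longrightarrow>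
             as_dual_M P repL repM pstar
               \<in> subdifferential (eps_risk P repM V e) (Mstar \<omega>) \<inter> range (as_dual_M P repL repM)
             \<and> is_arg_max (\<lambda>f. \<integral>\<theta>. f \<theta> * repM (Mstar \<omega>) \<theta> \<partial>P)
                 (\<lambda>f. f \<in> eps_densities P repL repM V e) (repL pstar)"
proof -
  interpret finite_risk_disutility P repL repM V
    using spaces V finite_risk
    by (simp add: finite_risk_disutility_def finite_risk_disutility_axioms_def)
  \<comment> \<open>Countably many null sets are merged into one before any accumulation point is
    chosen, so the exceptional set does not depend on \<open>pstar\<close>.\<close>
  have "AE \<omega> in \<Omega>. \<forall>N. as_dual_M P repL repM (p N \<omega>)
      \<in> subdifferential (eps_risk P repM V (eps N)) (class_of P repM (M N \<omega>))"
    using p_sub by (simp add: AE_all_countable)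
  then show ?thesis
    using M_lim
  proof eventually_elim
    case (elim \<omega>)
    show ?case
    proof (intro allI impI)
      fix q assume "seq_accumulation_point (sigma_L_M P repL repM) (\<lambda>N. p N \<omega>) q"
      then obtain k where k: "strict_mono k"
        and lim: "limitin (weak_topology (\<lambda>X q. pair q X)) ((\<lambda>N. p N \<omega>) \<circ> k) q sequentially"
        unfolding seq_accumulation_point_def sigma_L_M_def by blast
      have sub: "(\<forall>Y. pair (p N \<omega>) Y \<le> env (eps N) Y) \<and>
          env (eps N) (class_of P repM (M N \<omega>)) \<le> pair (p N \<omega>) (class_of P repM (M N \<omega>))" for N
        using elim(1) subdifferential_iff[OF eps_nonneg] by blast
      have "(\<lambda>n. pair (p (k n) \<omega>) X) \<longlonglongrightarrow> pair q X" for X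
        using limitin_weak_topology_imp_tendsto[OF lim] by simp
      moreover have "(\<lambda>n. eps (k n)) \<longlonglongrightarrow> e"
        using LIMSEQ_subseq_LIMSEQ[OF eps_lim k] by (simp add: comp_def)
      moreover have "(\<lambda>n. class_of P repM (M (k n) \<omega>)) \<longlonglongrightarrow> Mstar \<omega>"
        using LIMSEQ_subseq_LIMSEQ[OF elim(2) k] by (simp add: comp_def)
      \<comment> \<open>Along the subsequence \<open>k\<close> both support inequalities pass to the
        limit; they are then read back as the subgradient property and as optimality.\<close>
      ultimately have q: "pair q Y \<le> env e Y" "env e (Mstar \<omega>) \<le> pair q (Mstar \<omega>)" for Y
        using support_limit[of "\<lambda>n. pair (p (k n) \<omega>)" "\<lambda>n. eps (k n)"
            "\<lambda>n. class_of P repM (M (k n) \<omega>)" e "Mstar \<omega>" "pair q"]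
          linear_pair sub eps_nonneg by blast+
      then show "as_dual_M P repL repM q
            \<in> subdifferential (eps_risk P repM V e) (Mstar \<omega>) \<inter> range (as_dual_M P repL repM)
          \<and> is_arg_max (\<lambda>f. \<integral>\<theta>. f \<theta> * repM (Mstar \<omega>) \<theta> \<partial>P)
              (\<lambda>f. f \<in> eps_densities P repL repM V e) (repL q)"
        using subdifferential_iff[OF e_nonneg] subgradient_is_arg_max[OF e_nonneg] by blast
    qed
  qed
qed

end
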